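(* Let $p>4$, $\omega>0$ and $c=2\sqrt{\omega}$ be fixed. For $b>0$ let $\varphi$ be the positive, even $H^1(\mathbb{R})$ solution of $$-\varphi_{xx}+\tfrac{c}{2}|\varphi|^2\varphi-\tfrac{3}{16}|\varphi|^4\varphi-b|\varphi|^p\varphi=0,$$ and let $\varphi_0$ be the corresponding solution for $b=0$. Then the soliton profile $\varphi$ changes regularly with respect to the perturbation $b|u|^pu$; more precisely, for $b$ sufficiently small, $$\|\varphi-\varphi_0\|_{L^\infty}=O(\sqrt[4]{b}),\qquad \|\varphi-\varphi_0\|_{L^2}=O(\sqrt[4]{b}).$$
   Context: $O(\sqrt[4]{b})$ denotes a quantity bounded by $C\sqrt[4]{b}$ with $C>0$ independent of $b$ (as $b\downarrow0$, with $\omega,c,p$ fixed). Explicitly, $\varphi_0>0$ and $\varphi_0^2(x)=\frac{4c}{(cx)^2+1}$. *)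

theory Defs
  imports "HOL-Analysis.Analysis" "HOL-Probability.Essential_Supremum"
begin

text \<open>
  Functions on the real line are considered up to Lebesgue-null sets; every equivalence class
  has a Borel representative, so we work with Lebesgue measure on the Borel sets. Derivatives of Sobolev functions are
  weak derivatives, tested against compactly supported functions of class C1. In one dimension
  this yields the same weak derivatives as smooth compactly supported test functions.
\<close>

definition test_function :: "(real \<Rightarrow> real) \<Rightarrow> bool" where
  "test_function \<eta> \<longleftrightarrow> \<eta> C1_differentiable_on UNIV \<and> compact (closure {x. \<eta> x \<noteq> 0})"

definition locally_integrable :: "(real \<Rightarrow> real) \<Rightarrow> bool" where
  "locally_integrable u \<longleftrightarrow> (\<forall>a b. set_integrable lborel {a..b} u)"

definition has_weak_deriv :: "(real \<Rightarrow> real) \<Rightarrow> (real \<Rightarrow> real) \<Rightarrow> bool" where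
  "has_weak_deriv u g \<longleftrightarrow> locally_integrable u \<and> locally_integrable g \<and>
     (\<forall>\<eta>. test_function \<eta> \<longrightarrow>
        (LINT x|lborel. u x * deriv \<eta> x) = - (LINT x|lborel. g x * \<eta> x))"

definition square_integrable :: "(real \<Rightarrow> real) \<Rightarrow> bool" where
  "square_integrable u \<longleftrightarrow> u \<in> borel_measurable lborel \<and> integrable lborel (\<lambda>x. (u x)\<^sup>2)"

definition in_H1 :: "(real \<Rightarrow> real) \<Rightarrow> bool" where
  "in_H1 u \<longleftrightarrow> square_integrable u \<and> (\<exists>g. square_integrable g \<and> has_weak_deriv u g)"

text \<open>
  The functions g and h are the first and second weak derivatives of the profile. No continuity
  of the chosen representative is assumed.
\<close>

definition soliton_profile :: "real \<Rightarrow> real \<Rightarrow> real \<Rightarrow> (real \<Rightarrow> real) \<Rightarrow> bool" where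
  "soliton_profile c p b \<phi> \<longleftrightarrow>
     in_H1 \<phi> \<and> (\<forall>x. \<phi> x > 0) \<and> (\<forall>x. \<phi> (- x) = \<phi> x) \<and>
     (\<exists>g h. has_weak_deriv \<phi> g \<and> has_weak_deriv g h \<and>
        (AE x in lborel.
           - h x + c / 2 * \<bar>\<phi> x\<bar> ^ 2 * \<phi> x - 3 / 16 * \<bar>\<phi> x\<bar> ^ 4 * \<phi> x
             - b * (\<bar>\<phi> x\<bar> powr p) * \<phi> x = 0))"

definition Linf_norm :: "(real \<Rightarrow> real) \<Rightarrow> ereal" where
  "Linf_norm f = esssup lborel (\<lambda>x. ereal \<bar>f x\<bar>)"

text \<open>
  The following is the norm only for square integrable functions; outside of that space the
  Bochner integral defaults to zero.
\<close>

definition L2_norm :: "(real \<Rightarrow> real) \<Rightarrow> real" where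
  "L2_norm f = sqrt (LINT x|lborel. (f x)\<^sup>2)"

end

theory Submission
  imports Defs
begin

text \<open>
  The proof rests on the substitution $w = 1/\varphi^2$. A soliton profile is, up to a null set, a
  classical solution $v$ of $v'' = N(v)$, and decay in $H^1$ forces the energy to be zero:
  \[ (v')^2 = \tfrac{c}{4} v^4 - \tfrac{1}{16} v^6 - \tfrac{2b}{p+2} v^{p+2}. \]
  Eliminating $v'$ from the second derivative of $w$ with this identity leaves
  \[ w'' = \tfrac{c}{2} + \tfrac{2b(p-4)}{p+2}\, v^{p-2}, \qquad w'(0) = 0. \]
  For $b = 0$ the solution is the parabola $w_0(x) = ((cx)^2 + 1)/(4c)$. For $b > 0$ the first integral
  still gives $v^2 \le 4c$, so $w'' - w_0''$ lies between 0 and a multiple of $b$, and at $x = 0$ it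
  gives the same for $w - w_0$. Two integrations yield $w_0 \le w \le (1 + Kb) w_0$ on the whole line with
  $K$ depending only on $c$ and $p$. Taking square roots, $0 \le \varphi_0 - \varphi \le K b \varphi_0$. Both norms of the
  difference are therefore $O(b)$, which for $b < 1$ is stronger than $O(\sqrt[4]{b})$.
  
  The step from weak to classical solutions is the du Bois-Reymond lemma
  (\<open>weak_deriv_imp_AE_eq_primitive\<close>, \<open>soliton_profile_classical\<close>); the vanishing of the energy
  is \<open>soliton_first_integral\<close>, and the comparison of $w$ with $w_0$ is \<open>inverse_square_bounds\<close>.
\<close>

section \<open>Locally integrable functions and their primitives\<close>

lemma locally_integrable_Icc:
  "locally_integrable u \<Longrightarrow> set_integrable lborel {a..b} u"
  by (simp add: locally_integrable_def)

lemma locally_integrable_measurable: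
  assumes "locally_integrable u"
  shows "u \<in> borel_measurable lborel"
proof (rule borel_measurable_LIMSEQ_real)
  fix x :: real
  obtain N :: nat where N: "\<bar>x\<bar> \<le> real N" using real_arch_simple by blast
  show "(\<lambda>n. indicator {- real n..real n} x *\<^sub>R u x) \<longlonglongrightarrow> u x"
  proof (rule tendsto_eventually, unfold eventually_sequentially, intro exI allI impI)
    fix n assume "N \<le> n"
    then have "real N \<le> real n" by simp
    with N have "x \<in> {- real n..real n}" by (auto simp: abs_le_iff)
    then show "indicator {- real n..real n} x *\<^sub>R u x = u x" by simp
  qed
next
  fix n :: nat
  show "(\<lambda>x. indicator {- real n..real n} x *\<^sub>R u x) \<in> borel_measurable lborel"
    using locally_integrable_Icc[OF assms, of "- real n" "real n"]
    unfolding set_integrable_def by (rule borel_measurable_integrable)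
qed

lemma locally_integrable_diff:
  "locally_integrable u \<Longrightarrow> locally_integrable v \<Longrightarrow> locally_integrable (\<lambda>x. u x - v x)"
  by (simp add: locally_integrable_def)

lemma locally_integrable_continuous:
  assumes "continuous_on UNIV u"
  shows "locally_integrable u"
  unfolding locally_integrable_def
  using borel_integrable_atLeastAtMost' continuous_on_subset[OF assms] by blast

lemma locally_integrable_interval_integrable:
  fixes a b :: real
  assumes "locally_integrable u"
  shows "interval_lebesgue_integrable lborel a b u"
proof -
  have *: "set_integrable lborel {a<..<b} u" for a b :: real
    by (rule set_integrable_subset[OF locally_integrable_Icc[OF assms, of a b]]) auto
  show ?thesis by (simp add: interval_lebesgue_integrable_def *)
qed

lemma locally_integrable_interval_integral_sum:
  fixes a b c :: real
  assumes "locally_integrable u"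
  shows "(LBINT x=a..b. u x) + (LBINT x=b..c. u x) = (LBINT x=a..c. u x)"
proof -
  have "interval_lebesgue_integrable lborel (ereal (min a (min b c))) (ereal (max a (max b c))) u"
    by (rule locally_integrable_interval_integrable[OF assms])
  then show ?thesis
    by (intro interval_integral_sum) (simp add: ereal_min ereal_max)
qed

text \<open>
  The compact intervals generate the Borel sets. Cut off to $[-n, n]$ the function is integrable,
  and the sets on which its integral vanishes are closed under complements (the total integral is
  itself an integral over an interval) and disjoint unions; so the integral vanishes on all Borel
  sets, and then the function does almost everywhere.
\<close>

lemma AE_zero_if_interval_integrals_zero:
  assumes f: "locally_integrable f"
    and zero: "\<And>a b. a \<le> b \<Longrightarrow> (LINT x:{a..b}|lborel. f x) = 0"
  shows "AE x in lborel. f x = 0"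
proof -
  have "AE x in lborel. indicator {- real n..real n} x *\<^sub>R f x = 0" for n :: nat
  proof (rule sigma_finite_measure.density_zero[OF sigma_finite_lborel])
    let ?F = "\<lambda>x. indicator {- real n..real n} x *\<^sub>R f x"
    show int: "integrable lborel ?F"
      using locally_integrable_Icc[OF f] by (simp add: set_integrable_def)
    have intA: "set_integrable lborel A ?F" if "A \<in> sets borel" for A
      unfolding set_integrable_def by (rule integrable_mult_indicator) (use that int in auto)
    fix A assume "A \<in> sets (lborel :: real measure)"
    then have "A \<in> sets borel" by simp
    then show "(LINT x:A|lborel. ?F x) = 0"
    proof (induction rule: borel_set_induct)
      case empty
      then show ?case by (simp add: set_lebesgue_integral_def)
    next
      case (interval a b)
      have "(LINT x:{a..b}|lborel. ?F x) = (LINT x:{max a (- real n)..min b (real n)}|lborel. f x)"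
        unfolding set_lebesgue_integral_def
        by (intro Bochner_Integration.integral_cong) (auto split: split_indicator)
      also have "\<dots> = 0"
        by (cases "max a (- real n) \<le> min b (real n)")
          (simp add: zero del: max.bounded_iff min.bounded_iff, simp add: set_lebesgue_integral_def)
      finally show ?case .
    next
      case (compl A)
      have "(LINT x:A \<union> -A|lborel. ?F x) = (LINT x:A|lborel. ?F x) + (LINT x:-A|lborel. ?F x)"
        by (rule set_integral_Un) (use compl intA in \<open>auto simp: Compl_eq_Diff_UNIV\<close>)
      moreover have "(LINT x:A \<union> -A|lborel. ?F x) = (LINT x:{- real n..real n}|lborel. f x)"
        by (simp add: set_lebesgue_integral_def)
      moreover have "(LINT x:{- real n..real n}|lborel. f x) = 0"
        by (rule zero) simp
      ultimately show ?case using compl by simp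
    next
      case (union A)
      have "(LINT x:(\<Union>i. A i)|lborel. ?F x) = (\<Sum>i. (LINT x:A i|lborel. ?F x))"
        by (rule lebesgue_integral_countable_add)
          (use union intA in \<open>auto simp: disjoint_family_on_def\<close>)
      then show ?case using union by simp
    qed
  qed
  then have "AE x in lborel. \<forall>n::nat. indicator {- real n..real n} x *\<^sub>R f x = 0"
    by (rule AE_all_countable[THEN iffD2, rule_format])
  then show ?thesis
  proof eventually_elim
    case (elim x)
    obtain n :: nat where n: "\<bar>x\<bar> \<le> real n" using real_arch_simple by blast
    then have "x \<in> {- real n..real n}" by (auto simp: abs_le_iff)
    with elim[rule_format, of n] show ?case by simp
  qed
qed

lemma DERIV_primitive:
  fixes \<theta> :: "real \<Rightarrow> real" and c x :: real
  assumes "continuous_on UNIV \<theta>"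
  shows "((\<lambda>x. LBINT t=c..x. \<theta> t) has_real_derivative \<theta> x) (at x)"
proof -
  let ?a = "min c x - 1" and ?b = "max c x + 1"
  have "((\<lambda>x. LBINT t=c..x. \<theta> t) has_vector_derivative \<theta> x) (at x within {?a..?b})"
    by (rule interval_integral_FTC2) (auto intro: continuous_on_subset[OF assms])
  then show ?thesis
    by (simp add: has_real_derivative_iff_has_vector_derivative at_within_Icc_at)
qed

section \<open>The du Bois-Reymond lemma\<close>

text \<open>
  The derivatives of test functions are exactly the compactly supported continuous functions of
  mean zero: to the right of the support the primitive equals the total integral, which is zero.
\<close>

lemma test_function_primitive:
  assumes cont: "continuous_on UNIV \<theta>"
    and supp: "\<And>x. \<bar>x\<bar> > R \<Longrightarrow> \<theta> x = 0"
    and mean: "(LINT x|lborel. \<theta> x) = 0"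
  shows "\<exists>\<eta>. test_function \<eta> \<and> deriv \<eta> = \<theta>"
proof (intro exI conjI)
  define r where "r = \<bar>R\<bar> + 1"
  have r: "r > 0" "\<And>x. \<bar>x\<bar> \<ge> r \<Longrightarrow> \<theta> x = 0"
    using supp by (auto simp: r_def)
  let ?\<eta> = "\<lambda>x::real. LBINT t=-r..x. \<theta> t"
  have D: "(?\<eta> has_real_derivative \<theta> x) (at x)" for x
    using DERIV_primitive[OF cont, of "-r" x] by simp
  show "deriv ?\<eta> = \<theta>" using D DERIV_imp_deriv by blast
  have C1: "?\<eta> C1_differentiable_on UNIV"
    unfolding C1_differentiable_on_def
    using D cont by (auto simp: has_real_derivative_iff_has_vector_derivative)
  have left: "?\<eta> x = 0" if "x \<le> -r" for x
  proof -
    have "?\<eta> x = - (LBINT t=x..-r. \<theta> t)" by (rule interval_integral_endpoints_reverse)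
    also have "(LBINT t=x..-r. \<theta> t) = (LINT t:{x..-r}|lborel. \<theta> t)"
      using interval_integral_Icc[OF that, of \<theta>] by simp
    also have "\<dots> = (LINT t:{x..-r}|lborel. 0)"
      using r by (intro set_lebesgue_integral_cong) auto
    finally show ?thesis by (simp add: set_lebesgue_integral_def)
  qed
  have right: "?\<eta> x = 0" if "x \<ge> r" for x
  proof -
    have "?\<eta> x = (LINT t:{-r..x}|lborel. \<theta> t)"
      using interval_integral_Icc[of "-r" x \<theta>] that r by simp
    also have "\<dots> = (LINT t|lborel. \<theta> t)"
      unfolding set_lebesgue_integral_def
      using r that by (intro Bochner_Integration.integral_cong) (auto split: split_indicator)
    finally show ?thesis using mean by simp
  qed
  have "{x. ?\<eta> x \<noteq> 0} \<subseteq> {-r..r}"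
  proof
    fix x :: real assume "x \<in> {x. ?\<eta> x \<noteq> 0}"
    then have "\<not> x \<le> -r" "\<not> x \<ge> r" using left[of x] right[of x] by blast+
    then show "x \<in> {-r..r}" by simp
  qed
  then have "closure {x. ?\<eta> x \<noteq> 0} \<subseteq> {-r..r}"
    by (rule closure_minimal) simp
  then have "compact (closure {x. ?\<eta> x \<noteq> 0})"
    using bounded_subset[OF bounded_closed_interval] by (simp add: compact_eq_bounded_closed)
  with C1 show "test_function ?\<eta>" by (simp add: test_function_def)
qed

lemma test_functionE:
  assumes "test_function \<eta>"
  obtains R where "R > 0" "\<And>x. (\<eta> has_real_derivative deriv \<eta> x) (at x)"
    "continuous_on UNIV (deriv \<eta>)" "\<And>x. \<bar>x\<bar> \<ge> R \<Longrightarrow> \<eta> x = 0" "\<And>x. \<bar>x\<bar> \<ge> R \<Longrightarrow> deriv \<eta> x = 0"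
proof -
  from assms obtain D where D: "\<And>x. (\<eta> has_vector_derivative D x) (at x)" "continuous_on UNIV D"
    by (auto simp: test_function_def C1_differentiable_on_def)
  then have D': "(\<eta> has_real_derivative D x) (at x)" for x
    by (simp add: has_real_derivative_iff_has_vector_derivative)
  then have eq: "deriv \<eta> = D" using DERIV_imp_deriv by blast
  from assms have "bounded {x. \<eta> x \<noteq> 0}"
    using bounded_subset[OF compact_imp_bounded closure_subset] by (simp add: test_function_def)
  then obtain B where B: "B > 0" "\<And>x. \<eta> x \<noteq> 0 \<Longrightarrow> \<bar>x\<bar> \<le> B"
    by (auto simp: bounded_pos)
  show thesis
  proof (rule that[of "B + 1"])
    show "B + 1 > 0" using B by simp
    show "(\<eta> has_real_derivative deriv \<eta> x) (at x)" for x using D' eq by simp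
    show "continuous_on UNIV (deriv \<eta>)" using D eq by simp
    show "\<eta> x = 0" if "\<bar>x\<bar> \<ge> B + 1" for x using B(2)[of x] that by force
    show "deriv \<eta> x = 0" if "\<bar>x\<bar> \<ge> B + 1" for x
    proof -
      have "((\<lambda>_. 0) has_real_derivative 0) (at x)" by simp
      then have "(\<eta> has_real_derivative 0) (at x)"
      proof (rule has_field_derivative_transform_within_open)
        show "open (- {-B..B})" by (intro open_Compl) simp
        show "x \<in> - {-B..B}" using that by auto
        show "\<And>y. y \<in> - {-B..B} \<Longrightarrow> 0 = \<eta> y" using B(2) by (fastforce simp: abs_le_iff)
      qed
      then show ?thesis by (rule DERIV_imp_deriv)
    qed
  qed
qed


text \<open>
  On $[x - 1, x + 1]$ the primitive differs by a constant from the indefinite Henstock-Kurzweil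
  integral starting at $x - 1$, which is continuous.
\<close>

lemma continuous_on_primitive:
  assumes g: "locally_integrable g"
  shows "continuous_on UNIV (\<lambda>x::real. LBINT t=0..x. g t)"
proof -
  let ?U = "\<lambda>x::real. LBINT t=0..x. g t"
  have "isCont ?U x" for x
  proof -
    let ?a = "x - 1" and ?b = "x + 1"
    have "g integrable_on {?a..?b}"
      by (rule set_borel_integral_eq_integral(1)[OF locally_integrable_Icc[OF g]])
    then have "continuous_on {?a..?b} (\<lambda>y. ?U ?a + integral {?a..y} g)"
      by (intro continuous_intros indefinite_integral_continuous_1)
    moreover have "?U ?a + integral {?a..y} g = ?U y" if "y \<in> {?a..?b}" for y
    proof -
      have "integral {?a..y} g = (LBINT t=?a..y. g t)"
        using set_borel_integral_eq_integral(2)[OF locally_integrable_Icc[OF g, of ?a y]]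
          interval_integral_Icc[of ?a y g] that by simp
      then show ?thesis
        using locally_integrable_interval_integral_sum[OF g, of 0 ?a y]
        by (simp add: zero_ereal_def)
    qed
    ultimately have "continuous_on {?a..?b} ?U"
      by (rule continuous_on_eq)
    then show ?thesis by (rule continuous_on_interior) simp
  qed
  then show ?thesis by (simp add: continuous_at_imp_continuous_on)
qed

text \<open>
  With $g$ merely locally integrable the primitive need not be differentiable everywhere, so
  integration by parts is replaced by Fubini: for a test function $\eta$ supported in $[-R, R]$,
  both sides are the integral of $g(t)\,\eta'(x)$ over the triangle $-R \le t \le x \le R$,
  up to a multiple of the mean of $\eta'$, which is zero.
\<close>

lemma primitive_has_weak_deriv:
  assumes g: "locally_integrable g"
  shows "has_weak_deriv (\<lambda>x::real. LBINT t=0..x. g t) g"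
  unfolding has_weak_deriv_def
proof (intro conjI allI impI)
  let ?U = "\<lambda>x::real. LBINT t=0..x. g t"
  show "locally_integrable ?U"
    by (rule locally_integrable_continuous[OF continuous_on_primitive[OF g]])
  fix \<eta> assume "test_function \<eta>"
  then obtain R where R: "R > 0"
    and D: "\<And>x. (\<eta> has_real_derivative deriv \<eta> x) (at x)"
    and cont: "continuous_on UNIV (deriv \<eta>)"
    and \<eta>0: "\<And>x. \<bar>x\<bar> \<ge> R \<Longrightarrow> \<eta> x = 0" and \<theta>0: "\<And>x. \<bar>x\<bar> \<ge> R \<Longrightarrow> deriv \<eta> x = 0"
    by (rule test_functionE) blast
  define \<theta> where "\<theta> = deriv \<eta>"
  \<comment> \<open>The integrand on the triangle, extended by zero, so that Fubini applies on the whole plane.\<close>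
  define G where "G = (\<lambda>t. indicator {-R..R} t *\<^sub>R g t)"
  define F where "F = (\<lambda>x t. (if t \<le> x then 1 else 0) * (G t * \<theta> x))"
  note cont = cont[folded \<theta>_def] and \<theta>0 = \<theta>0[folded \<theta>_def] and D = D[folded \<theta>_def]
  have G: "integrable lborel G"
    using locally_integrable_Icc[OF g] by (simp add: set_integrable_def G_def)
  have [measurable]: "G \<in> borel_measurable borel" "\<theta> \<in> borel_measurable borel"
    using borel_measurable_integrable[OF G] borel_measurable_continuous_onI[OF cont] by simp_all
  have \<theta>_restrict: "indicator {-R..R} x *\<^sub>R \<theta> x = \<theta> x" for x
    using \<theta>0[of x] by (cases "\<bar>x\<bar> \<ge> R") (auto simp: indicator_def)
  have \<theta>: "integrable lborel \<theta>"
    using locally_integrable_Icc[OF locally_integrable_continuous[OF cont], of "-R" R]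
    by (simp add: set_integrable_def \<theta>_restrict[unfolded real_scaleR_def])
  have FTC: "(LINT x:{a..b}|lborel. \<theta> x) = \<eta> b - \<eta> a" if "a \<le> b" for a b
    unfolding set_lebesgue_integral_def
    using that D cont by (intro integral_FTC_atLeastAtMost)
      (auto intro: continuous_on_subset has_field_derivative_at_within 
        simp flip: has_real_derivative_iff_has_vector_derivative)
  have mean: "(LINT x|lborel. \<theta> x) = 0"
    using FTC[of "-R" R] R \<eta>0[of R] \<eta>0[of "-R"]
    by (simp add: set_lebesgue_integral_def \<theta>_restrict[unfolded real_scaleR_def])
  have U: "?U x * \<theta> x = ?U (-R) * \<theta> x + (LINT t|lborel. F x t)" for x
  proof (cases "\<bar>x\<bar> \<ge> R")
    case True
    then show ?thesis by (simp add: \<theta>0 F_def)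
  next
    case False
    then have "-R \<le> x" "x \<le> R" by auto
    have "?U x = ?U (-R) + (LINT t:{-R..x}|lborel. g t)"
      using locally_integrable_interval_integral_sum[OF g, of 0 "-R" x]
        interval_integral_Icc[OF \<open>-R \<le> x\<close>, of g] by (simp add: zero_ereal_def)
    also have "(LINT t:{-R..x}|lborel. g t) = (LINT t|lborel. (if t \<le> x then 1 else 0) * G t)"
      unfolding set_lebesgue_integral_def G_def using \<open>x \<le> R\<close>
      by (intro Bochner_Integration.integral_cong) (auto simp: indicator_def)
    finally have "?U x * \<theta> x = ?U (-R) * \<theta> x + (LINT t|lborel. (if t \<le> x then 1 else 0) * G t) * \<theta> x"
      by (simp add: algebra_simps)
    also have "(LINT t|lborel. (if t \<le> x then 1 else 0) * G t) * \<theta> x = (LINT t|lborel. F x t)"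
      by (simp add: F_def mult.assoc flip: Bochner_Integration.integral_mult_left_zero)
    finally show ?thesis .
  qed
  have inner: "(LINT x|lborel. F x t) = - (g t * \<eta> t)" for t
  proof (cases "t \<in> {-R..R}")
    case False
    then have "\<bar>t\<bar> \<ge> R" by auto
    with False show ?thesis by (simp add: F_def G_def \<eta>0)
  next
    case True
    have "(LINT x|lborel. F x t) = (LINT x|lborel. g t * (indicator {t..R} x *\<^sub>R \<theta> x))"
      using True \<theta>0
      by (intro Bochner_Integration.integral_cong) (auto simp: F_def G_def indicator_def)
    also have "\<dots> = g t * (LINT x:{t..R}|lborel. \<theta> x)"
      unfolding set_lebesgue_integral_def by (rule Bochner_Integration.integral_mult_right_zero)
    finally show ?thesis using True R by (simp add: FTC \<eta>0)
  qed
  have F: "integrable (lborel \<Otimes>\<^sub>M lborel) (case_prod F)"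
  proof (rule Bochner_Integration.integrable_bound)
    show "integrable (lborel \<Otimes>\<^sub>M lborel) (\<lambda>(x,t). G t * \<theta> x)"
    proof (rule lborel_pair.Fubini_integrable)
      show "(\<lambda>(x, t). G t * \<theta> x) \<in> borel_measurable (lborel \<Otimes>\<^sub>M lborel)" by measurable
      show "integrable lborel (\<lambda>x. LINT y|lborel. norm (case (x, y) of (x, t) \<Rightarrow> G t * \<theta> x))"
        using integrable_mult_right[OF integrable_abs[OF \<theta>], of "LINT t|lborel. \<bar>G t\<bar>"]
        by (simp add: abs_mult)
      show "AE x in lborel. integrable lborel (\<lambda>y. case (x, y) of (x, t) \<Rightarrow> G t * \<theta> x)"
        using G by simp
    qed
    show "case_prod F \<in> borel_measurable (lborel \<Otimes>\<^sub>M lborel)"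
      unfolding F_def by measurable
    show "AE x in lborel \<Otimes>\<^sub>M lborel. norm (case_prod F x) \<le> norm (case x of (x, t) \<Rightarrow> G t * \<theta> x)"
      by (auto simp: F_def)
  qed
  have "(LINT x|lborel. ?U x * \<theta> x) = (LINT x|lborel. ?U (-R) * \<theta> x + (LINT t|lborel. F x t))"
    by (simp add: U)
  also have "\<dots> = (LINT x|lborel. ?U (-R) * \<theta> x) + (LINT x|lborel. LINT t|lborel. F x t)"
    using \<theta> lborel_pair.integrable_fst'[OF F] by (intro Bochner_Integration.integral_add) auto
  also have "(LINT x|lborel. ?U (-R) * \<theta> x) = 0" by (simp add: mean)
  also have "(LINT x|lborel. LINT t|lborel. F x t) = (LINT t|lborel. LINT x|lborel. F x t)"
    by (rule lborel_pair.Fubini_integral[OF F, symmetric])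
  also have "\<dots> = - (LINT t|lborel. g t * \<eta> t)" by (simp add: inner)
  finally show "(LINT x|lborel. ?U x * deriv \<eta> x) = - (LINT x|lborel. g x * \<eta> x)"
    by (simp add: \<theta>_def)
qed (rule g)


text \<open>
  Continuous functions that decrease to the indicator of $[a, b]$ as $n \to \infty$; the slope
  is at least 1, so that all of them live on $[a - 1, b + 1]$.
\<close>

definition plateau :: "real \<Rightarrow> real \<Rightarrow> nat \<Rightarrow> real \<Rightarrow> real" where
  "plateau a b n x = max 0 (1 - real (Suc n) * (max 0 (a - x) + max 0 (x - b)))"

lemma continuous_on_plateau: "continuous_on A (plateau a b n)"
  unfolding plateau_def by (intro continuous_intros)

lemma plateau_eq_1: "x \<in> {a..b} \<Longrightarrow> plateau a b n x = 1"
  by (simp add: plateau_def)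

lemma plateau_le_indicator: "\<bar>plateau a b n x\<bar> \<le> indicator {a - 1..b + 1} x"
proof -
  have "plateau a b n x = 0" if "d \<ge> 1" "max 0 (a - x) + max 0 (x - b) = d" for d
  proof -
    have "1 * 1 \<le> real (Suc n) * d" using that by (intro mult_mono) auto
    then show ?thesis unfolding plateau_def that(2) by simp
  qed
  moreover have "max 0 (a - x) + max 0 (x - b) \<ge> 1" if "x \<notin> {a - 1..b + 1}"
    using that by auto
  ultimately have "plateau a b n x = 0" if "x \<notin> {a - 1..b + 1}" using that by blast
  moreover have "0 \<le> plateau a b n x" "plateau a b n x \<le> 1" by (auto simp: plateau_def)
  ultimately show ?thesis by (auto simp: indicator_def)
qed

lemma plateau_tendsto_indicator: "(\<lambda>n. plateau a b n x) \<longlonglongrightarrow> indicator {a..b} x"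
proof (cases "x \<in> {a..b}")
  case True
  then show ?thesis by (simp add: plateau_eq_1)
next
  case False
  define d where "d = max 0 (a - x) + max 0 (x - b)"
  have "d > 0" using False by (auto simp: d_def)
  then obtain N where N: "1 < real N * d" using reals_Archimedean3 by blast
  have "plateau a b n x = 0" if "n \<ge> N" for n
  proof -
    have "real N * d \<le> real (Suc n) * d" using that \<open>d > 0\<close> by (intro mult_right_mono) auto
    with N show ?thesis unfolding plateau_def d_def[symmetric] by simp
  qed
  then show ?thesis using False
    by (intro tendsto_eventually) (auto simp: eventually_sequentially indicator_def)
qed

lemma integrable_mult_bump:
  assumes f: "locally_integrable f" and "continuous_on UNIV \<psi>"
    and le: "\<And>x. \<bar>\<psi> x\<bar> \<le> indicator {a..b} x"
  shows "integrable lborel (\<lambda>x. f x * \<psi> x)"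
proof (rule Bochner_Integration.integrable_bound)
  show "integrable lborel (\<lambda>x. indicator {a..b} x *\<^sub>R f x)"
    using locally_integrable_Icc[OF f] by (simp add: set_integrable_def)
  show "(\<lambda>x. f x * \<psi> x) \<in> borel_measurable lborel"
    using locally_integrable_measurable[OF f] borel_measurable_continuous_onI[OF assms(2)] by simp
  show "AE x in lborel. norm (f x * \<psi> x) \<le> norm (indicator {a..b} x *\<^sub>R f x)"
    using mult_left_mono[OF le abs_ge_zero]
    by (intro always_eventually) (simp add: abs_mult mult.commute[of _ "\<bar>f _\<bar>"])
qed

text \<open>
  Subtracting from a plateau the right multiple of a fixed bump $\kappa$ leaves a function of mean
  zero, that is, the derivative of a test function. Hence $f$ integrates every plateau as the constant
  $k$ does. In the limit $f$ and $k$ have the same integral over every interval.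
\<close>

lemma du_Bois_Reymond:
  assumes f: "locally_integrable f"
    and zero: "\<And>\<eta>. test_function \<eta> \<Longrightarrow> (LINT x|lborel. f x * deriv \<eta> x) = 0"
  shows "\<exists>k. AE x in lborel. f x = k"
proof -
  define \<kappa> where "\<kappa> = plateau 0 1 0"
  have one: "locally_integrable (\<lambda>_. 1)" by (rule locally_integrable_continuous) simp
  have int: "integrable lborel (\<lambda>x. f x * plateau a b n x)"
      "integrable lborel (plateau a b n)" for a b n
    using integrable_mult_bump[OF f continuous_on_plateau plateau_le_indicator]
      integrable_mult_bump[OF one continuous_on_plateau plateau_le_indicator] by simp_all
  define m where "m = (LINT x|lborel. \<kappa> x)"
  have "(LINT x|lborel. indicator {0..1::real} x) \<le> m"
    unfolding m_def \<kappa>_def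
  proof (rule integral_mono)
    fix x :: real
    show "indicator {0..1} x \<le> plateau 0 1 0 x"
      using plateau_eq_1[of x 0 1 0] by (auto simp: indicator_def plateau_def)
  qed (use int in auto)
  then have "m > 0" by simp
  define k where "k = (LINT x|lborel. f x * \<kappa> x) / m"
  have mean: "(LINT x|lborel. f x * plateau a b n x) = k * (LINT x|lborel. plateau a b n x)" for a b n
  proof -
    \<comment> \<open>the factor that makes the mean vanish\<close>
    define s where "s = (LINT x|lborel. plateau a b n x) / m"
    define \<theta> where "\<theta> = (\<lambda>x. plateau a b n x - s * \<kappa> x)"
    have "\<exists>\<eta>. test_function \<eta> \<and> deriv \<eta> = \<theta>"
    proof (rule test_function_primitive)
      show "continuous_on UNIV \<theta>"
        unfolding \<theta>_def \<kappa>_def by (intro continuous_intros continuous_on_plateau)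
      show "\<theta> x = 0" if "\<bar>x\<bar> > max 2 (max \<bar>a - 1\<bar> \<bar>b + 1\<bar>)" for x
      proof -
        from that have "x \<notin> {a - 1..b + 1}" "x \<notin> {0 - 1..1 + 1}" by auto
        then have "\<bar>plateau a b n x\<bar> \<le> 0" "\<bar>\<kappa> x\<bar> \<le> 0"
          unfolding \<kappa>_def by (metis plateau_le_indicator indicator_simps(2))+
        then show ?thesis by (simp add: \<theta>_def)
      qed
      show "(LINT x|lborel. \<theta> x) = 0"
      proof -
        have "(LINT x|lborel. \<theta> x) = (LINT x|lborel. plateau a b n x) - s * m"
          using int by (simp add: \<theta>_def \<kappa>_def m_def)
        then show ?thesis using \<open>m > 0\<close> by (simp add: s_def)
      qed
    qed
    then have "(LINT x|lborel. f x * \<theta> x) = 0" using zero by blast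
    moreover have "(LINT x|lborel. f x * \<theta> x) =
        (LINT x|lborel. f x * plateau a b n x - s * (f x * \<kappa> x))"
      by (intro Bochner_Integration.integral_cong) (simp_all add: \<theta>_def algebra_simps)
    moreover have "\<dots> = (LINT x|lborel. f x * plateau a b n x) - s * (LINT x|lborel. f x * \<kappa> x)"
      using int by (simp add: \<kappa>_def)
    ultimately show ?thesis by (simp add: s_def k_def)
  qed
  have "AE x in lborel. f x - k = 0"
  proof (rule AE_zero_if_interval_integrals_zero)
    show "locally_integrable (\<lambda>x. f x - k)"
      by (intro locally_integrable_diff f locally_integrable_continuous) simp
    fix a b :: real assume "a \<le> b"
    have lim: "(\<lambda>n. LINT x|lborel. g x * plateau a b n x) \<longlonglongrightarrow> (LINT x:{a..b}|lborel. g x)"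
      if g: "locally_integrable g" for g
      unfolding set_lebesgue_integral_def
    proof (rule integral_dominated_convergence)
      have [measurable]: "g \<in> borel_measurable borel"
        using locally_integrable_measurable[OF g] by simp
      show "(\<lambda>x. indicator {a..b} x *\<^sub>R g x) \<in> borel_measurable lborel" by simp
      show "(\<lambda>x. g x * plateau a b n x) \<in> borel_measurable lborel" for n
        using borel_measurable_continuous_onI[OF continuous_on_plateau] by simp
      show "integrable lborel (\<lambda>x. \<bar>indicator {a - 1..b + 1} x *\<^sub>R g x\<bar>)"
        using locally_integrable_Icc[OF g, of "a - 1" "b + 1"]
        unfolding set_integrable_def by (rule integrable_abs)
      show "AE x in lborel. (\<lambda>n. g x * plateau a b n x) \<longlonglongrightarrow> indicator {a..b} x *\<^sub>R g x"
        using tendsto_mult_left[OF plateau_tendsto_indicator]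
        by (intro always_eventually) (simp add: mult.commute)
      show "AE x in lborel. norm (g x * plateau a b n x) \<le> \<bar>indicator {a - 1..b + 1} x *\<^sub>R g x\<bar>" for n
        using mult_left_mono[OF plateau_le_indicator abs_ge_zero]
        by (intro always_eventually) (auto simp: abs_mult mult.commute)
    qed
    have "(\<lambda>n. k * (LINT x|lborel. plateau a b n x)) \<longlonglongrightarrow> k * (LINT x:{a..b}|lborel. 1)"
      using tendsto_mult_left[OF lim[OF one]] by simp
    from LIMSEQ_unique[OF lim[OF f, unfolded mean] this]
    have "(LINT x:{a..b}|lborel. f x) = k * (LINT x:{a..b}|lborel. 1)" .
    moreover have "(LINT x:{a..b}|lborel. f x - k) = (LINT x:{a..b}|lborel. f x) - (LINT x:{a..b}|lborel. k * 1)"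
      using locally_integrable_Icc[OF f] locally_integrable_Icc[OF locally_integrable_continuous[of "\<lambda>_. k"]]
      by (subst set_integral_diff) auto
    moreover have "(LINT x:{a..b}|lborel. k * 1) = k * (LINT x:{a..b}|lborel. 1)"
      by (rule set_integral_mult_right)
    ultimately show "(LINT x:{a..b}|lborel. f x - k) = 0" by linarith
  qed
  then show ?thesis by auto
qed

lemma integrable_mult_test_function:
  assumes f: "locally_integrable f" and "continuous_on UNIV \<psi>" "\<And>x. \<bar>x\<bar> \<ge> R \<Longrightarrow> \<psi> x = 0"
  shows "integrable lborel (\<lambda>x. f x * \<psi> x)"
proof -
  have "compact (\<psi> ` {-R..R})"
    by (rule compact_continuous_image[OF continuous_on_subset[OF assms(2)]]) auto
  then have "bounded (\<psi> ` {-R..R})" by (rule compact_imp_bounded)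
  then obtain B where "B > 0" "\<forall>y\<in>\<psi> ` {-R..R}. norm y \<le> B"
    unfolding bounded_pos by blast
  then have B: "B > 0" "\<And>x. x \<in> {-R..R} \<Longrightarrow> \<bar>\<psi> x\<bar> \<le> B" by auto
  have "integrable lborel (\<lambda>x. f x * (\<psi> x / B))"
  proof (rule integrable_mult_bump[OF f])
    show "continuous_on UNIV (\<lambda>x. \<psi> x / B)"
      using assms(2) B(1) by (intro continuous_intros) auto
    show "\<bar>\<psi> x / B\<bar> \<le> indicator {-R..R} x" for x
      using B assms(3)[of x] by (cases "x \<in> {-R..R}") (auto simp: divide_simps)
  qed
  from integrable_mult_right[OF this, of B] show ?thesis
    using B(1) by simp
qed

text \<open>
  The du Bois-Reymond lemma applies to the difference of $u$ and the primitive of $g$, because both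
  have the weak derivative $g$.
\<close>

lemma weak_deriv_imp_AE_eq_primitive:
  assumes "has_weak_deriv u g"
  shows "\<exists>k. AE x in lborel. u x = k + (LBINT t=0..x. g t)"
proof -
  let ?U = "\<lambda>x::real. LBINT t=0..x. g t"
  from assms have u: "locally_integrable u" and g: "locally_integrable g"
    by (auto simp: has_weak_deriv_def)
  have U: "has_weak_deriv ?U g" by (rule primitive_has_weak_deriv[OF g])
  then have intU: "locally_integrable ?U" by (simp add: has_weak_deriv_def)
  have "\<exists>k. AE x in lborel. u x - ?U x = k"
  proof (rule du_Bois_Reymond)
    show "locally_integrable (\<lambda>x. u x - ?U x)" by (rule locally_integrable_diff[OF u intU])
    fix \<eta> assume \<eta>: "test_function \<eta>"
    then obtain R where "continuous_on UNIV (deriv \<eta>)" "\<And>x. \<bar>x\<bar> \<ge> R \<Longrightarrow> deriv \<eta> x = 0"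
      by (rule test_functionE) blast
    note int = integrable_mult_test_function[OF _ this]
    have "(LINT x|lborel. u x * deriv \<eta> x) = (LINT x|lborel. ?U x * deriv \<eta> x)"
      using assms U \<eta> by (simp add: has_weak_deriv_def)
    then show "(LINT x|lborel. (u x - ?U x) * deriv \<eta> x) = 0"
      using int[OF u] int[OF intU] by (simp add: left_diff_distrib)
  qed
  then obtain k where "AE x in lborel. u x - ?U x = k" by blast
  then have "AE x in lborel. u x = k + ?U x" by eventually_elim simp
  then show ?thesis by blast
qed

section \<open>Classical regularity of soliton profiles\<close>

lemma mem_closed_if_AE_lborel:
  fixes C :: "real set"
  assumes "closed C" "AE x in lborel. x \<in> C"
  shows "x \<in> C"
  by (rule mem_closed_if_AE_lebesgue[OF assms(1)]) (rule AE_completion[OF assms(2)])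

lemma primitive_eq_imp_AE_eq:
  assumes f: "locally_integrable f" and g: "locally_integrable g"
    and eq: "\<And>x::real. k + (LBINT t=0..x. f t) = l + (LBINT t=0..x. g t)"
  shows "AE x in lborel. f x = g x"
proof -
  have "AE x in lborel. f x - g x = 0"
  proof (rule AE_zero_if_interval_integrals_zero[OF locally_integrable_diff[OF f g]])
    fix a b :: real assume "a \<le> b"
    have *: "(LINT x:{a..b}|lborel. u x) = (LBINT t=0..b. u t) - (LBINT t=0..a. u t)"
      if "locally_integrable u" for u
      using locally_integrable_interval_integral_sum[OF that, of 0 a b]
        interval_integral_Icc[OF \<open>a \<le> b\<close>, of u] by (simp add: zero_ereal_def)
    have "(LINT x:{a..b}|lborel. f x) = (LINT x:{a..b}|lborel. g x)"
      unfolding *[OF f] *[OF g] using eq[of a] eq[of b] by linarith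
    then show "(LINT x:{a..b}|lborel. f x - g x) = 0"
      using locally_integrable_Icc[OF f] locally_integrable_Icc[OF g] by simp
  qed
  then show ?thesis by simp
qed

lemma primitive_cong_AE:
  fixes x :: real
  assumes "locally_integrable f" "locally_integrable g" "AE x in lborel. f x = g x"
  shows "(LBINT t=0..x. f t) = (LBINT t=0..x. g t)"
  using assms locally_integrable_measurable by (intro interval_integral_cong_AE) auto

text \<open>
  The right-hand side of the profile equation in the form $\varphi'' = N(\varphi)$. It is evaluated
  only at arguments $s \ge 0$, where the absolute values of the original equation can be dropped.
\<close>

definition soliton_force :: "real \<Rightarrow> real \<Rightarrow> real \<Rightarrow> real \<Rightarrow> real" where
  "soliton_force c p b s = c / 2 * s ^ 3 - 3 / 16 * s ^ 5 - b * (s powr p * s)"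

text \<open>
  A profile agrees almost everywhere with a primitive $v$ of its weak derivative, and the weak
  derivative with a primitive $d$ of the second weak derivative. By the equation the second weak
  derivative is almost everywhere the continuous function $N(v)$, so $v$ is twice differentiable. Pointwise relations that are closed
  conditions (sign, symmetry) pass from $\varphi$ to $v$; strict positivity is not closed and survives
  at this stage only as $v \ge 0$ and $v \ne 0$. The square integrable weak derivative of the
  $H^1$ condition could a priori differ from the one in the equation; it is identified with $d$
  because both have the same primitive.
\<close>

lemma soliton_profile_classical:
  assumes "soliton_profile c p b \<phi>" "p > 0"
  obtains v d where
    "\<And>x. (v has_real_derivative d x) (at x)"
    "\<And>x. (d has_real_derivative soliton_force c p b (v x)) (at x)"
    "\<And>x. v x \<ge> 0" "\<And>x. v (- x) = v x" "\<exists>x. v x > 0"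
    "AE x in lborel. \<phi> x = v x"
    "integrable lborel (\<lambda>x. (v x)\<^sup>2 + (d x)\<^sup>2)"
proof -
  from assms(1) obtain g h g1 where gh: "has_weak_deriv \<phi> g" "has_weak_deriv g h"
    and ode: "AE x in lborel. - h x + c / 2 * \<bar>\<phi> x\<bar> ^ 2 * \<phi> x - 3 / 16 * \<bar>\<phi> x\<bar> ^ 4 * \<phi> x
             - b * (\<bar>\<phi> x\<bar> powr p) * \<phi> x = 0"
    and pos: "\<And>x. \<phi> x > 0" and even: "\<And>x. \<phi> (- x) = \<phi> x"
    and g1: "has_weak_deriv \<phi> g1" and sq: "square_integrable \<phi>" "square_integrable g1"
    unfolding soliton_profile_def in_H1_def by blast
  have li: "locally_integrable \<phi>" "locally_integrable g" "locally_integrable h" "locally_integrable g1"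
    using gh g1 by (simp_all add: has_weak_deriv_def)
  obtain k1 k2 k3 where k1: "AE x in lborel. \<phi> x = k1 + (LBINT t=0..x. g t)"
    and k2: "AE x in lborel. g x = k2 + (LBINT t=0..x. h t)"
    and k3: "AE x in lborel. \<phi> x = k3 + (LBINT t=0..x. g1 t)"
    using gh g1 weak_deriv_imp_AE_eq_primitive by meson
  define v where "v = (\<lambda>x::real. k1 + (LBINT t=0..x. g t))"
  define d where "d = (\<lambda>x::real. k2 + (LBINT t=0..x. h t))"
  let ?N = "soliton_force c p b"
  have cont_v: "continuous_on UNIV v" and cont_d: "continuous_on UNIV d"
    unfolding v_def d_def using li by (auto intro!: continuous_intros continuous_on_primitive)
  have [measurable]: "v \<in> borel_measurable borel" "\<phi> \<in> borel_measurable borel"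
    "d \<in> borel_measurable borel" "g1 \<in> borel_measurable borel"
    using borel_measurable_continuous_onI[OF cont_v] borel_measurable_continuous_onI[OF cont_d]
      sq by (simp_all add: square_integrable_def)
  have \<phi>v: "AE x in lborel. \<phi> x = v x" using k1 by (simp add: v_def)
  have gd: "AE x in lborel. g x = d x" using k2 by (simp add: d_def)
  have v_eq: "v = (\<lambda>x. k1 + (LBINT t=0..x. d t))"
    unfolding v_def using primitive_cong_AE[OF li(2) locally_integrable_continuous[OF cont_d] gd] by simp
  have v_nonneg: "v x \<ge> 0" for x
  proof -
    have "x \<in> {x. 0 \<le> v x}"
    proof (rule mem_closed_if_AE_lborel)
      show "closed {x. 0 \<le> v x}" by (intro closed_Collect_le cont_v continuous_intros)
      show "AE x in lborel. x \<in> {x. 0 \<le> v x}"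
        using \<phi>v by eventually_elim (metis mem_Collect_eq pos less_imp_le)
    qed
    then show ?thesis by simp
  qed
  have cont_N: "continuous_on UNIV (\<lambda>x. ?N (v x))"
    unfolding soliton_force_def
    by (intro continuous_intros continuous_on_powr' cont_v) (use v_nonneg \<open>p > 0\<close> in auto)
  have hN: "AE x in lborel. h x = ?N (v x)"
    using ode \<phi>v
  proof eventually_elim
    case (elim x)
    then show ?case using v_nonneg[of x]
      by (simp add: soliton_force_def power_numeral_reduce)
  qed
  have d_eq: "d = (\<lambda>x. k2 + (LBINT t=0..x. ?N (v t)))"
    unfolding d_def using primitive_cong_AE[OF li(3) locally_integrable_continuous[OF cont_N] hN] by simp
  have dv: "(v has_real_derivative d x) (at x)" for x
    using DERIV_primitive[OF cont_d, of 0 x]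
    by (subst v_eq) (auto intro!: derivative_eq_intros simp: zero_ereal_def)
  have dd: "(d has_real_derivative ?N (v x)) (at x)" for x
    using DERIV_primitive[OF cont_N, of 0 x]
    by (subst d_eq) (auto intro!: derivative_eq_intros simp: zero_ereal_def)
  have v_even: "v (- x) = v x" for x
  proof -
    have "AE x in distr lborel borel uminus. \<phi> x = v x"
      using \<phi>v by (simp only: lborel_distr_uminus)
    then have *: "AE x in lborel. \<phi> (- x) = v (- x)"
      by (subst (asm) AE_distr_iff) auto
    have "x \<in> {x. v (- x) = v x}"
    proof (rule mem_closed_if_AE_lborel)
      show "closed {x. v (- x) = v x}"
        by (intro closed_Collect_eq continuous_on_compose2[OF cont_v] continuous_intros) auto
      show "AE x in lborel. x \<in> {x. v (- x) = v x}"
        using \<phi>v * by eventually_elim (simp add: even)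
    qed
    then show ?thesis by simp
  qed
  have v_pos: "\<exists>x. v x > 0"
  proof (rule ccontr)
    assume "\<nexists>x. v x > 0"
    have "0 \<in> ({} :: real set)"
    proof (rule mem_closed_if_AE_lborel)
      show "AE x in lborel. x \<in> ({} :: real set)"
        using \<phi>v by eventually_elim (metis \<open>\<nexists>x. v x > 0\<close> pos)
    qed simp
    then show False by simp
  qed
  have "k1 + (LBINT t=0..x. d t) = k3 + (LBINT t=0..x. g1 t)" for x :: real
  proof -
    have "x \<in> {x. v x = k3 + (LBINT t=0..x. g1 t)}"
    proof (rule mem_closed_if_AE_lborel)
      show "closed {x. v x = k3 + (LBINT t=0..x. g1 t)}"
        using li by (intro closed_Collect_eq cont_v continuous_intros continuous_on_primitive)
      show "AE x in lborel. x \<in> {x. v x = k3 + (LBINT t=0..x. g1 t)}"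
        using \<phi>v k3 by eventually_elim simp
    qed
    then show ?thesis by (simp add: v_eq)
  qed
  from primitive_eq_imp_AE_eq[OF locally_integrable_continuous[OF cont_d] li(4) this]
  have dg1: "AE x in lborel. d x = g1 x" .
  have "integrable lborel (\<lambda>x. (\<phi> x)\<^sup>2 + (g1 x)\<^sup>2)"
    using sq by (simp add: square_integrable_def)
  moreover have "AE x in lborel. (\<phi> x)\<^sup>2 + (g1 x)\<^sup>2 = (v x)\<^sup>2 + (d x)\<^sup>2"
    using \<phi>v dg1 by eventually_elim simp
  ultimately have "integrable lborel (\<lambda>x. (v x)\<^sup>2 + (d x)\<^sup>2)"
    by (subst (asm) integrable_cong_AE) auto
  then show thesis
    using that dv dd v_nonneg v_even v_pos \<phi>v by blast
qed

section \<open>The first integral and positivity\<close>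

text \<open>
  Multiplying $\varphi'' = N(\varphi)$ by $2 \varphi'$ and integrating gives $(\varphi')^2$ as a function of
  $\varphi$ up to a constant; this is the normalisation that vanishes at $\varphi = 0$.
\<close>

definition squared_slope :: "real \<Rightarrow> real \<Rightarrow> real \<Rightarrow> real \<Rightarrow> real" where
  "squared_slope c p b s = c / 4 * s ^ 4 - s ^ 6 / 16 - 2 * b / (p + 2) * (s powr p * s\<^sup>2)"

text \<open>
  The absolute value matters only at $s = 0$, where a two-sided derivative is wanted: the profile
  has not been shown to be strictly positive when this is used.
\<close>

lemma DERIV_powr_mult_square:
  fixes p s :: real
  assumes "p > 0" "s \<ge> 0"
  shows "((\<lambda>s. \<bar>s\<bar> powr p * s\<^sup>2) has_real_derivative (p + 2) * (s powr p * s)) (at s)"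
proof (cases "s = 0")
  case True
  \<comment> \<open>Caratheodory's criterion: this is the difference quotient at 0.\<close>
  have "isCont (\<lambda>z. \<bar>z\<bar> powr p * z) (0 :: real)"
    by (intro continuous_intros continuous_on_interior[of UNIV] continuous_on_powr')
      (use \<open>p > 0\<close> in auto)
  then have "((\<lambda>s. \<bar>s\<bar> powr p * s\<^sup>2) has_real_derivative 0) (at 0)"
    unfolding CARAT_DERIV
    by (intro exI[of _ "\<lambda>z. \<bar>z\<bar> powr p * z"]) (auto simp: power2_eq_square)
  with True show ?thesis by simp
next
  case False
  with assms have "s > 0" by simp
  have "((\<lambda>s. s powr p * s\<^sup>2) has_real_derivative (p + 2) * (s powr p * s)) (at s)"
  proof -
    have "((\<lambda>s. s powr p * s\<^sup>2) has_real_derivative p * s powr (p - 1) * s\<^sup>2 + s powr p * (2 * s)) (at s)"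
      using \<open>s > 0\<close> by (auto intro!: derivative_eq_intros)
    moreover have "s powr p = s powr (p - 1) * s"
      using \<open>s > 0\<close> by (simp add: powr_diff)
    ultimately show ?thesis by (simp add: algebra_simps power2_eq_square)
  qed
  then show ?thesis
    by (rule has_field_derivative_transform_within_open[where S = "{0<..}"])
      (use \<open>s > 0\<close> in auto)
qed

lemma energy_conserved:
  fixes v d :: "real \<Rightarrow> real"
  assumes dv: "\<And>x. (v has_real_derivative d x) (at x)"
    and dd: "\<And>x. (d has_real_derivative soliton_force c p b (v x)) (at x)"
    and nonneg: "\<And>x. v x \<ge> 0" and "p > 0"
  shows "\<exists>E. \<forall>x. (d x)\<^sup>2 = squared_slope c p b (v x) + E"
proof -
  have "((\<lambda>x. (d x)\<^sup>2 - (c / 4 * v x ^ 4 - v x ^ 6 / 16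
      - 2 * b / (p + 2) * (\<bar>v x\<bar> powr p * (v x)\<^sup>2))) has_real_derivative 0) (at x)" for x
  proof -
    define k T where "k = 2 * b / (p + 2)" and "T = (\<lambda>x. \<bar>v x\<bar> powr p * (v x)\<^sup>2)"
    have T: "(T has_real_derivative (p + 2) * (v x powr p * v x) * d x) (at x)"
      unfolding T_def by (rule DERIV_chain2[OF DERIV_powr_mult_square[OF \<open>p > 0\<close> nonneg] dv])
    have "((\<lambda>x. (d x)\<^sup>2 - (c / 4 * v x ^ 4 - v x ^ 6 / 16 - k * T x)) has_real_derivative
        2 * d x * soliton_force c p b (v x) - (c / 4 * (4 * v x ^ 3 * d x) - 6 * v x ^ 5 * d x / 16
          - k * ((p + 2) * (v x powr p * v x) * d x))) (at x)"
      by (auto intro!: derivative_eq_intros dv dd T)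
    moreover have "k * (p + 2) = 2 * b" using \<open>p > 0\<close> by (simp add: k_def)
    then have "k * ((p + 2) * (v x powr p * v x) * d x) = 2 * b * (v x powr p * v x) * d x"
      by (simp only: mult.assoc[symmetric])
    ultimately show ?thesis
      by (simp add: soliton_force_def k_def T_def algebra_simps)
  qed
  from DERIV_isconst_all[OF allI[OF this]]
  have "(d x)\<^sup>2 - squared_slope c p b (v x) = (d 0)\<^sup>2 - squared_slope c p b (v 0)" for x
    using nonneg unfolding squared_slope_def by (metis abs_of_nonneg)
  then show ?thesis
    by (intro exI[of _ "(d 0)\<^sup>2 - squared_slope c p b (v 0)"]) (metis add.commute diff_eq_eq)
qed

lemma integrable_imp_small_somewhere:
  fixes f :: "real \<Rightarrow> real"
  assumes "integrable lborel f" "\<epsilon> > 0"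
  shows "\<exists>x. f x < \<epsilon>"
proof (rule ccontr)
  assume "\<nexists>x. f x < \<epsilon>"
  then have "\<epsilon> \<le> f x" for x by (simp add: not_less)
  then have "integrable (lborel :: real measure) (\<lambda>_. \<epsilon>)"
    using \<open>\<epsilon> > 0\<close> by (intro Bochner_Integration.integrable_bound[OF assms(1)]) (auto intro: order_trans[OF _ abs_ge_self])
  then show False using \<open>\<epsilon> > 0\<close> by (simp add: integrable_iff_bounded ennreal_mult_top)
qed

lemma abs_squared_slope_le:
  assumes "0 \<le> s" "s \<le> 1" "c > 0" "b \<ge> 0" "p > 0"
  shows "\<bar>squared_slope c p b s\<bar> \<le> (c / 4 + 1 / 16 + 2 * b / (p + 2)) * s\<^sup>2"
proof -
  have "s ^ 4 \<le> s\<^sup>2" "s ^ 6 \<le> s\<^sup>2" using assms by (auto intro: power_decreasing)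
  moreover have "s powr p \<le> 1" using assms by (simp add: powr_le1)
  then have "s powr p * s\<^sup>2 \<le> s\<^sup>2" by (simp add: mult_left_le_one_le)
  ultimately have "c / 4 * s ^ 4 \<le> c / 4 * s\<^sup>2" "2 * b / (p + 2) * (s powr p * s\<^sup>2) \<le> 2 * b / (p + 2) * s\<^sup>2"
    "s ^ 6 / 16 \<le> s\<^sup>2 / 16"
    using assms by (auto intro!: mult_left_mono divide_right_mono)
  moreover have "0 \<le> c / 4 * s ^ 4" "0 \<le> s ^ 6 / 16" "0 \<le> 2 * b / (p + 2) * (s powr p * s\<^sup>2)"
    using assms by auto
  ultimately show ?thesis unfolding squared_slope_def ring_distribs by linarith
qed

text \<open>
  The energy constant is zero: since $v^2 + (v')^2$ is integrable over the line, it is arbitrarily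
  small somewhere, and there both $(v')^2$ and its expression in $v$ are small.
\<close>

lemma soliton_first_integral:
  fixes v d :: "real \<Rightarrow> real"
  assumes dv: "\<And>x. (v has_real_derivative d x) (at x)"
    and dd: "\<And>x. (d has_real_derivative soliton_force c p b (v x)) (at x)"
    and nonneg: "\<And>x. v x \<ge> 0"
    and int: "integrable lborel (\<lambda>x. (v x)\<^sup>2 + (d x)\<^sup>2)"
    and par: "p > 0" "c > 0" "b \<ge> 0"
  shows "(d x)\<^sup>2 = squared_slope c p b (v x)"
proof -
  obtain E where E: "\<And>x. (d x)\<^sup>2 = squared_slope c p b (v x) + E"
    using energy_conserved[OF dv dd nonneg \<open>p > 0\<close>] by blast
  \<comment> \<open>$|E| \le L (v^2 + (v')^2)$ wherever $v \le 1$\<close>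
  let ?L = "1 + (c / 4 + 1 / 16 + 2 * b / (p + 2))"
  have L: "?L > 0" using par by (simp add: add_pos_nonneg)
  have "\<bar>E\<bar> \<le> 0"
  proof (rule field_le_epsilon)
    fix e :: real assume "e > 0"
    then have "min 1 (e / ?L) > 0" using L by simp
    then obtain x where x: "(v x)\<^sup>2 + (d x)\<^sup>2 < min 1 (e / ?L)"
      using integrable_imp_small_somewhere[OF int] by blast
    then have "(v x)\<^sup>2 \<le> 1" using zero_le_power2[of "d x"] by linarith
    then have "v x \<le> 1" using nonneg[of x] by (simp add: power2_le_imp_le[of _ 1])
    note en = abs_squared_slope_le[OF nonneg this par(2,3,1)]
    have "\<bar>E\<bar> \<le> (d x)\<^sup>2 + \<bar>squared_slope c p b (v x)\<bar>" using E[of x] zero_le_power2[of "d x"] by linarith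
    also have "\<dots> \<le> ?L * ((v x)\<^sup>2 + (d x)\<^sup>2)"
    proof -
      have "0 \<le> (c / 4 + 1 / 16 + 2 * b / (p + 2)) * (d x)\<^sup>2" using par by auto
      with en zero_le_power2[of "v x"] show ?thesis by (simp only: ring_distribs)
    qed
    also have "\<dots> \<le> e"
      using x pos_less_divide_eq[OF L, of "(v x)\<^sup>2 + (d x)\<^sup>2" e]
      by (simp only: min_less_iff_conj mult.commute less_imp_le)
    finally show "\<bar>E\<bar> \<le> 0 + e" by simp
  qed
  then show ?thesis using E by simp
qed

text \<open>
  Nonnegativity of $(v')^2$ gives the bound on $v$, uniformly in $b \ge 0$ since the perturbation only
  lowers the expression. Inserting it back bounds the logarithmic derivative of $v$.
\<close>

lemma soliton_upper_bound:
  assumes fi: "(d::real)\<^sup>2 = squared_slope c p b v" and "v \<ge> 0" "p > 0" "c > 0" "b \<ge> 0"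
  shows "v\<^sup>2 \<le> 4 * c" "\<bar>d\<bar> \<le> c * v"
proof -
  have "0 \<le> 2 * b / (p + 2) * (v powr p * v\<^sup>2)" using assms by simp
  then have le: "d\<^sup>2 \<le> v ^ 4 * (4 * c - v\<^sup>2) / 16"
  proof -
    have "v ^ 4 * (4 * c - v\<^sup>2) / 16 = c / 4 * v ^ 4 - v ^ 6 / 16"
      by (simp add: diff_divide_distrib right_diff_distrib flip: power_add)
    with fi \<open>0 \<le> 2 * b / (p + 2) * (v powr p * v\<^sup>2)\<close> show ?thesis
      unfolding squared_slope_def by linarith
  qed
  show v: "v\<^sup>2 \<le> 4 * c"
  proof (cases "v = 0")
    case False
    have "0 \<le> v ^ 4 * (4 * c - v\<^sup>2)" using le zero_le_power2[of d] by linarith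
    moreover have "v ^ 4 > 0" using False by simp
    ultimately show ?thesis by (simp add: zero_le_mult_iff)
  qed (use assms in simp)
  have "d\<^sup>2 \<le> v\<^sup>2 * (v\<^sup>2 * (4 * c - v\<^sup>2) / 16)" using le by (simp add: power_numeral_reduce)
  also have "\<dots> \<le> v\<^sup>2 * c\<^sup>2"
  proof (rule mult_left_mono)
    have "v\<^sup>2 * (4 * c - v\<^sup>2) \<le> (4 * c) * (4 * c)" using v \<open>c > 0\<close> by (intro mult_mono) auto
    then show "v\<^sup>2 * (4 * c - v\<^sup>2) / 16 \<le> c\<^sup>2" by (simp add: power2_eq_square)
  qed simp
  finally have "d\<^sup>2 \<le> (c * v)\<^sup>2" by (simp add: power_mult_distrib mult.commute)
  then have "\<bar>d\<bar> \<le> \<bar>c * v\<bar>" by (simp only: abs_le_square_iff)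
  then show "\<bar>d\<bar> \<le> c * v" using assms by simp
qed

text \<open>
  A function with bounded logarithmic derivative cannot reach zero in finite time: $v e^{cx}$
  is nondecreasing and $v e^{-cx}$ nonincreasing.
\<close>

lemma log_Lipschitz_pos:
  fixes v d :: "real \<Rightarrow> real"
  assumes dv: "\<And>x. (v has_real_derivative d x) (at x)"
    and le: "\<And>x. \<bar>d x\<bar> \<le> c * v x" and "v a > 0"
  shows "v x > 0"
proof (cases "a \<le> x")
  case True
  have "v a * exp (c * a) \<le> v x * exp (c * x)"
  proof (rule DERIV_nonneg_imp_nondecreasing[OF True])
    fix y
    have "((\<lambda>x. v x * exp (c * x)) has_real_derivative (d y + c * v y) * exp (c * y)) (at y)"
      by (auto intro!: derivative_eq_intros dv simp: algebra_simps)
    moreover have "d y + c * v y \<ge> 0" using le[of y] by linarith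
    ultimately show "\<exists>z. ((\<lambda>x. v x * exp (c * x)) has_real_derivative z) (at y) \<and> 0 \<le> z"
      by (intro exI[of _ "(d y + c * v y) * exp (c * y)"]) simp
  qed
  moreover have "v a * exp (c * a) > 0" using assms(3) by simp
  ultimately have "v x * exp (c * x) > 0" by linarith
  then show ?thesis by (simp add: zero_less_mult_iff)
next
  case False
  then have "x \<le> a" by simp
  have "v a * exp (- c * a) \<le> v x * exp (- c * x)"
  proof (rule DERIV_nonpos_imp_nonincreasing[OF \<open>x \<le> a\<close>])
    fix y
    have "((\<lambda>x. v x * exp (- c * x)) has_real_derivative (d y - c * v y) * exp (- c * y)) (at y)"
      by (auto intro!: derivative_eq_intros dv simp: algebra_simps)
    moreover have "d y - c * v y \<le> 0" using le[of y] by linarith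
    ultimately show "\<exists>z. ((\<lambda>x. v x * exp (- c * x)) has_real_derivative z) (at y) \<and> z \<le> 0"
      by (intro exI[of _ "(d y - c * v y) * exp (- c * y)"]) (simp add: mult_nonpos_nonneg)
  qed
  moreover have "v a * exp (- c * a) > 0" using assms(3) by simp
  ultimately have "v x * exp (- c * x) > 0" by linarith
  then show ?thesis by (simp add: zero_less_mult_iff)
qed

lemma convex_critical_point_min:
  fixes f f' f'' :: "real \<Rightarrow> real"
  assumes f: "\<And>x. (f has_real_derivative f' x) (at x)"
    and f': "\<And>x. (f' has_real_derivative f'' x) (at x)"
    and f'': "\<And>x. f'' x \<ge> 0" and "f' 0 = 0"
  shows "f 0 \<le> f x"
proof (cases "0 \<le> x")
  case True
  have "f' y \<ge> 0" if "0 \<le> y" for y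
    using DERIV_nonneg_imp_nondecreasing[OF that, of f'] f' f'' \<open>f' 0 = 0\<close> by fastforce
  then show ?thesis using DERIV_nonneg_imp_nondecreasing[OF True, of f] f by blast
next
  case False
  then have "x \<le> 0" by simp
  have "f' y \<le> 0" if "y \<le> 0" for y
    using DERIV_nonneg_imp_nondecreasing[OF that, of f'] f' f'' \<open>f' 0 = 0\<close> by fastforce
  then show ?thesis using DERIV_nonpos_imp_nonincreasing[OF \<open>x \<le> 0\<close>, of f] f by blast
qed

section \<open>The inverse square of the profile\<close>

text \<open>
  The left-hand side is the second derivative of $1/v^2$. In this variable the cubic and quintic terms
  contribute only the constant $c/2$: the unperturbed equation becomes linear and the
  perturbation enters additively, with a sign.
\<close>

lemma soliton_inverse_square_second_deriv:
  fixes c p b v d :: real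
  assumes "v > 0" "p > 4" and fi: "d\<^sup>2 = squared_slope c p b v"
  shows "- 2 * soliton_force c p b v / v ^ 3 + 6 * d\<^sup>2 / v ^ 4
    = c / 2 + 2 * b / (p + 2) * (p - 4) * (v\<^sup>2 * v powr (p - 4))"
proof -
  define r k where "r = v powr (p - 4)" and "k = 2 * b / (p + 2)"
  have r: "v powr p = v ^ 4 * r"
    using \<open>v > 0\<close> by (simp add: r_def powr_diff)
  have k: "2 * b = k * (p + 2)" using \<open>p > 4\<close> by (simp add: k_def)
  have "2 * soliton_force c p b v = c * v ^ 3 - 3 / 8 * v ^ 5 - (2 * b) * (v ^ 4 * r * v)"
    by (simp add: soliton_force_def r)
  also have "\<dots> = v ^ 3 * (c - 3 / 8 * v\<^sup>2 - k * (p + 2) * (v\<^sup>2 * r))"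
    unfolding k by (simp add: algebra_simps power_numeral_reduce)
  finally have F: "2 * soliton_force c p b v / v ^ 3 = c - 3 / 8 * v\<^sup>2 - k * (p + 2) * (v\<^sup>2 * r)"
    using \<open>v > 0\<close> by simp
  have "d\<^sup>2 = c / 4 * v ^ 4 - v ^ 6 / 16 - k * (v ^ 4 * r * v\<^sup>2)"
    unfolding fi squared_slope_def r k_def ..
  also have "\<dots> = v ^ 4 * (c / 4 - v\<^sup>2 / 16 - k * (v\<^sup>2 * r))"
    by (simp add: algebra_simps power_numeral_reduce)
  finally have "d\<^sup>2 / v ^ 4 = c / 4 - v\<^sup>2 / 16 - k * (v\<^sup>2 * r)"
    using \<open>v > 0\<close> by simp
  then have "6 * d\<^sup>2 / v ^ 4 = 6 * (c / 4 - v\<^sup>2 / 16 - k * (v\<^sup>2 * r))" by simp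
  with F show ?thesis
    unfolding r_def[symmetric] k_def[symmetric] by (simp add: algebra_simps)
qed

text \<open>
  This is $1/\varphi_0^2$: the solution of $w'' = c/2$ with $w'(0) = 0$ and $w(0) = 1/(4c)$.
\<close>

definition inverse_square_profile :: "real \<Rightarrow> real \<Rightarrow> real" where
  "inverse_square_profile c x = ((c * x)\<^sup>2 + 1) / (4 * c)"

text \<open>
  By $v^2 \le 4c$ the power is an upper bound for $v^{p-4} = v^{p+1} / v^5$, the size of the perturbation
  relative to a quintic term.
\<close>

definition perturbation_const :: "real \<Rightarrow> real \<Rightarrow> real" where
  "perturbation_const c p = 32 * (4 * c) powr ((p - 4) / 2)"

text \<open>
  Let $e$ be the difference of $1/v^2$ and its unperturbed counterpart. Evenness gives $v'(0) = 0$, so the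
  first integral at 0 determines $e(0)$, which is nonnegative and $O(b)$. The identity for the
  second derivative gives $0 \le e'' = O(b)$, uniformly in $x$ because $v^2 \le 4c$. Integrating twice,
  $0 \le e \le O(b) (1 + x^2)$, and the unperturbed inverse square grows like $1 + x^2$ as well: the error
  is small relative to it.
\<close>

lemma inverse_square_bounds:
  fixes v d :: "real \<Rightarrow> real"
  assumes dv: "\<And>x. (v has_real_derivative d x) (at x)"
    and dd: "\<And>x. (d has_real_derivative soliton_force c p b (v x)) (at x)"
    and pos: "\<And>x. v x > 0" and even: "\<And>x. v (- x) = v x"
    and fi: "\<And>x. (d x)\<^sup>2 = squared_slope c p b (v x)"
    and par: "p > 4" "c > 0" "b \<ge> 0"
  shows "inverse_square_profile c x \<le> 1 / (v x)\<^sup>2"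
    "1 / (v x)\<^sup>2 \<le> (1 + perturbation_const c p * b) * inverse_square_profile c x"
proof -
  define B where "B = (4 * c) powr ((p - 4) / 2)"
  have v_le: "(v x)\<^sup>2 \<le> 4 * c" for x
    using soliton_upper_bound(1)[OF fi[of x]] pos[of x] par by simp
  \<comment> \<open>Since $p > 4$ the exponent is positive, so the upper bound on $v$ also bounds this power.\<close>
  define r where "r = (\<lambda>x. v x powr (p - 4))"
  have r: "0 \<le> r x" "r x \<le> B" for x
  proof -
    have "r x = (v x powr 2) powr ((p - 4) / 2)"
      unfolding powr_powr r_def by (rule arg_cong[where f = "\<lambda>y. v x powr y"]) simp
    also have "\<dots> = ((v x)\<^sup>2) powr ((p - 4) / 2)"
      using powr_numeral[OF less_imp_le[OF pos[of x]], of "Num.Bit0 Num.One"] by (simp only:)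
    also have "\<dots> \<le> B" unfolding B_def using v_le par by (intro powr_mono2) auto
    finally show "r x \<le> B" .
  qed (simp add: r_def)
  define k where "k = 2 * b / (p + 2)"
  have k: "0 \<le> k" "k \<le> 2 * b" "k * (p - 4) \<le> 2 * b"
    using par by (simp_all add: k_def field_simps mult_left_mono)
  have "B \<ge> 0" by (simp add: B_def)
  define e where "e = (\<lambda>x. 1 / (v x)\<^sup>2 - inverse_square_profile c x)"
  define e' where "e' = (\<lambda>x. - 2 * d x / v x ^ 3 - c * x / 2)"
  define e'' where "e'' = (\<lambda>x. k * (p - 4) * ((v x)\<^sup>2 * r x))"
  have v0: "v x \<noteq> 0" for x using pos[of x] by simp
  have e: "(e has_real_derivative e' x) (at x)" for x
  proof -
    have "(e has_real_derivative - (2 * v x * d x) / ((v x)\<^sup>2 * (v x)\<^sup>2) - (2 * (c * x) * c) / (4 * c)) (at x)"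
      unfolding e_def inverse_square_profile_def using v0[of x] \<open>c > 0\<close>
      by (auto intro!: derivative_eq_intros dv)
    moreover have "- (2 * v x * d x) / ((v x)\<^sup>2 * (v x)\<^sup>2) - (2 * (c * x) * c) / (4 * c) = e' x"
      using v0[of x] \<open>c > 0\<close> by (simp add: e'_def field_simps power_numeral_reduce)
    ultimately show ?thesis by simp
  qed
  have e': "(e' has_real_derivative e'' x) (at x)" for x
  proof -
    let ?N = "soliton_force c p b (v x)"
    have "(e' has_real_derivative (- 2 * ?N * v x ^ 3 - (- 2 * d x) * (3 * (v x)\<^sup>2 * d x)) / (v x ^ 3 * v x ^ 3) - c / 2) (at x)"
      unfolding e'_def
    proof (intro DERIV_diff DERIV_divide)
      show "((\<lambda>x. - 2 * d x) has_real_derivative - 2 * ?N) (at x)"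
        by (auto intro!: derivative_eq_intros dd)
      show "((\<lambda>x. v x ^ 3) has_real_derivative 3 * (v x)\<^sup>2 * d x) (at x)"
        by (auto intro!: derivative_eq_intros dv)
      show "((\<lambda>x. c * x / 2) has_real_derivative c / 2) (at x)"
        by (auto intro!: derivative_eq_intros)
    qed (use v0[of x] in simp)
    moreover have "(- 2 * ?N * v x ^ 3 - (- 2 * d x) * (3 * (v x)\<^sup>2 * d x)) / (v x ^ 3 * v x ^ 3)
        = - 2 * ?N / v x ^ 3 + 6 * (d x)\<^sup>2 / v x ^ 4"
      using v0[of x] by (simp add: field_simps power_numeral_reduce)
    moreover note soliton_inverse_square_second_deriv[OF pos \<open>p > 4\<close> fi, of x]
    ultimately show ?thesis by (simp add: e''_def k_def r_def)
  qed
  have "d 0 = 0"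
  proof -
    have "((\<lambda>x. v (- x)) has_real_derivative - d (- 0)) (at 0)"
      using dv[of "- 0"] by (simp only: DERIV_mirror)
    then have "(v has_real_derivative - d 0) (at 0)" by (simp add: even)
    from DERIV_unique[OF dv this] show ?thesis by simp
  qed
  then have e'0: "e' 0 = 0" by (simp add: e'_def)
  have e0: "e 0 = 4 * k * r 0 / c"
  proof -
    have "0 = c / 4 * v 0 ^ 4 - v 0 ^ 6 / 16 - k * (v 0 ^ 4 * r 0 * (v 0)\<^sup>2)"
      using fi[of 0] \<open>d 0 = 0\<close> pos[of 0]
      by (simp add: squared_slope_def k_def r_def powr_diff)
    then have "v 0 ^ 4 * c = v 0 ^ 4 * ((v 0)\<^sup>2 * (1 / 4 + 4 * k * r 0))"
      by (simp add: algebra_simps flip: power_add)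
    then have c_eq: "c = (v 0)\<^sup>2 * (1 / 4 + 4 * k * r 0)"
      by (rule mult_left_cancel[OF power_not_zero[OF v0], THEN iffD1])
    have "c / (v 0)\<^sup>2 = 1 / 4 + 4 * k * r 0"
      by (subst c_eq, rule nonzero_mult_div_cancel_left) (simp add: v0)
    moreover have "c * e 0 = c / (v 0)\<^sup>2 - 1 / 4"
      using \<open>c > 0\<close> by (simp add: e_def inverse_square_profile_def right_diff_distrib)
    ultimately have "c * e 0 = 4 * k * r 0" by simp
    then show ?thesis using \<open>c > 0\<close> by (simp add: eq_divide_eq mult.commute)
  qed
  have e0_bounds: "0 \<le> e 0" "e 0 \<le> 8 * b * B / c"
  proof -
    show "0 \<le> e 0" using k r[of 0] par by (simp add: e0)
    have "k * r 0 \<le> 2 * b * B" using k r[of 0] par by (intro mult_mono) auto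
    then have "4 * k * r 0 \<le> 8 * b * B" by linarith
    then show "e 0 \<le> 8 * b * B / c"
      unfolding e0 by (rule divide_right_mono) (use par in simp)
  qed
  have e''_bounds: "0 \<le> e'' x" "e'' x \<le> 8 * b * c * B" for x
  proof -
    show "0 \<le> e'' x" using k r[of x] par by (simp add: e''_def)
    have "e'' x \<le> (2 * b) * ((4 * c) * B)"
      unfolding e''_def
      using k r[of x] v_le[of x] par by (intro mult_mono[OF k(3)] mult_mono) auto
    then show "e'' x \<le> 8 * b * c * B" by simp
  qed
  have "e 0 \<le> e x"
    by (rule convex_critical_point_min[OF e e' e''_bounds(1) e'0])
  with e0_bounds show "inverse_square_profile c x \<le> 1 / (v x)\<^sup>2" by (simp add: e_def)
  \<comment> \<open>The parabola has second derivative $8bcB \ge e''$, so subtracting $e$ leaves a convex function.\<close>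
  have "4 * b * c * B * 0\<^sup>2 - e 0 \<le> 4 * b * c * B * x\<^sup>2 - e x"
  proof (rule convex_critical_point_min)
    show "((\<lambda>x. 4 * b * c * B * x\<^sup>2 - e x) has_real_derivative 8 * b * c * B * x - e' x) (at x)" for x
      by (auto intro!: derivative_eq_intros e)
    show "((\<lambda>x. 8 * b * c * B * x - e' x) has_real_derivative 8 * b * c * B - e'' x) (at x)" for x
      by (auto intro!: derivative_eq_intros e')
  qed (use e''_bounds e'0 in auto)
  with e0_bounds have "e x \<le> 8 * b * B / c + 4 * b * c * B * x\<^sup>2" by simp
  \<comment> \<open>Doubling the quadratic term makes the bound a multiple of the unperturbed inverse square.\<close>
  also have "\<dots> \<le> 8 * b * B / c + 8 * b * c * B * x\<^sup>2"
    using par \<open>B \<ge> 0\<close> by (simp add: mult_right_mono)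
  also have "\<dots> = perturbation_const c p * b * inverse_square_profile c x"
    unfolding perturbation_const_def B_def[symmetric] inverse_square_profile_def
    using par by (simp add: field_simps power2_eq_square)
  finally show "1 / (v x)\<^sup>2 \<le> (1 + perturbation_const c p * b) * inverse_square_profile c x"
    by (simp add: e_def algebra_simps)
qed

text \<open>
  For $b = 0$ the two bounds coincide and give the explicit formula for $\varphi_0$.
\<close>

lemma soliton_profile_inverse_square_bounds:
  assumes prof: "soliton_profile c p b \<phi>" and par: "p > 4" "c > 0" "b \<ge> 0"
  shows "AE x in lborel. inverse_square_profile c x \<le> 1 / (\<phi> x)\<^sup>2 \<and>
    1 / (\<phi> x)\<^sup>2 \<le> (1 + perturbation_const c p * b) * inverse_square_profile c x"
proof -
  have p: "p > 0" using par by simp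
  obtain v d where dv: "\<And>x. (v has_real_derivative d x) (at x)"
    and dd: "\<And>x. (d has_real_derivative soliton_force c p b (v x)) (at x)"
    and nonneg: "\<And>x. v x \<ge> 0" and even: "\<And>x. v (- x) = v x" and ex: "\<exists>x. v x > 0"
    and eq: "AE x in lborel. \<phi> x = v x"
    and int: "integrable lborel (\<lambda>x. (v x)\<^sup>2 + (d x)\<^sup>2)"
    using soliton_profile_classical[OF prof p] by blast
  have fi: "(d x)\<^sup>2 = squared_slope c p b (v x)" for x
    by (rule soliton_first_integral[OF dv dd nonneg int p par(2,3)])
  have "\<bar>d x\<bar> \<le> c * v x" for x
    by (rule soliton_upper_bound(2)[OF fi nonneg p par(2,3)])
  then have "v x > 0" for x
    using ex log_Lipschitz_pos[OF dv] by blast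
  note bounds = inverse_square_bounds[OF dv dd this even fi par]
  show ?thesis using eq by eventually_elim (simp add: bounds)
qed

text \<open>
  The error relative to $\varphi_0$ is uniformly $O(b)$. This form yields the $L^\infty$ and the
  $L^2$ estimate alike, with the corresponding norm of $\varphi_0$ as a factor.
\<close>

lemma soliton_profile_pointwise_close:
  assumes prof0: "soliton_profile c p 0 \<phi>0" and prof: "soliton_profile c p b \<phi>"
    and par: "p > 4" "c > 0" "b \<ge> 0"
  shows "AE x in lborel. \<bar>\<phi> x - \<phi>0 x\<bar> \<le> perturbation_const c p * b * \<phi>0 x \<and> \<phi>0 x \<le> 2 * sqrt c"
  using soliton_profile_inverse_square_bounds[OF prof0 par(1,2) order_refl]
    soliton_profile_inverse_square_bounds[OF prof par]
proof eventually_elim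
  case (elim x)
  define t where "t = perturbation_const c p * b"
  have "t \<ge> 0" using par by (simp add: t_def perturbation_const_def)
  have pos: "\<phi> x > 0" "\<phi>0 x > 0" using prof prof0 by (auto simp: soliton_profile_def)
  let ?w = "inverse_square_profile c x"
  have w0: "?w = 1 / (\<phi>0 x)\<^sup>2" using elim by simp
  with elim have *: "1 / (\<phi>0 x)\<^sup>2 \<le> 1 / (\<phi> x)\<^sup>2" "1 / (\<phi> x)\<^sup>2 \<le> (1 + t) * (1 / (\<phi>0 x)\<^sup>2)"
    by (simp_all add: t_def)
  have cross: "n \<le> s * m" if "m > 0" "n > 0" "1 / m \<le> s * (1 / n)" for m n s :: real
    using that by (simp add: field_simps)
  have "(\<phi> x)\<^sup>2 \<le> (\<phi>0 x)\<^sup>2" using cross[of "(\<phi>0 x)\<^sup>2" "(\<phi> x)\<^sup>2" 1] *(1) pos by simp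
  then have le: "\<phi> x \<le> \<phi>0 x" by (rule power2_le_imp_le) (use pos in simp)
  have "(\<phi>0 x)\<^sup>2 \<le> (1 + t) * (\<phi> x)\<^sup>2" using cross[OF _ _ *(2)] pos by simp
  also have "\<dots> \<le> (1 + t)\<^sup>2 * (\<phi> x)\<^sup>2"
    using \<open>t \<ge> 0\<close> by (intro mult_right_mono self_le_power) simp_all
  finally have "\<phi>0 x \<le> (1 + t) * \<phi> x"
    using pos \<open>t \<ge> 0\<close> by (intro power2_le_imp_le[of "\<phi>0 x" "(1 + t) * \<phi> x"]) (simp_all add: power_mult_distrib)
  moreover have "t * \<phi> x \<le> t * \<phi>0 x" using le \<open>t \<ge> 0\<close> by (rule mult_left_mono)
  ultimately have "\<bar>\<phi> x - \<phi>0 x\<bar> \<le> t * \<phi>0 x" using le by (simp add: algebra_simps)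
  moreover have "\<phi>0 x \<le> 2 * sqrt c"
  proof -
    have "1 / (4 * c) \<le> ?w" using par by (simp add: inverse_square_profile_def divide_right_mono)
    then have "(\<phi>0 x)\<^sup>2 \<le> 4 * c" 
      using cross[of "4 * c" "(\<phi>0 x)\<^sup>2" 1] pos par by (simp add: w0)
    then have "(\<phi>0 x)\<^sup>2 \<le> (2 * sqrt c)\<^sup>2" using par by (simp add: power_mult_distrib)
    then show ?thesis by (rule power2_le_imp_le) (use par in simp)
  qed
  ultimately show ?case by (simp add: t_def)
qed

section \<open>The norm estimates\<close>

lemma root_4_ge:
  assumes "0 \<le> b" "b \<le> 1"
  shows "b \<le> root 4 b"
proof -
  have "b ^ 4 \<le> b ^ 1" using assms by (intro power_decreasing) auto
  then have "root 4 (b ^ 4) \<le> root 4 b" by simp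
  then show ?thesis using assms by (simp add: real_root_power_cancel)
qed

theorem lemma2p7:
  fixes p \<omega> c :: real and \<phi>0 :: "real \<Rightarrow> real"
  assumes "p > 4" and "\<omega> > 0" and "c = 2 * sqrt \<omega>"
    and "soliton_profile c p 0 \<phi>0"
  shows "\<exists>C>0. \<exists>b0>0. \<forall>b \<phi>. 0 < b \<and> b < b0 \<and> soliton_profile c p b \<phi> \<longrightarrow>
           Linf_norm (\<lambda>x. \<phi> x - \<phi>0 x) \<le> ereal (C * root 4 b) \<and>
           L2_norm (\<lambda>x. \<phi> x - \<phi>0 x) \<le> C * root 4 b"
proof -
  have "c > 0" using assms by simp
  define K where "K = perturbation_const c p"
  have "K > 0" using \<open>c > 0\<close> by (simp add: K_def perturbation_const_def)
  have sq0: "square_integrable \<phi>0" using assms(4) by (simp add: soliton_profile_def in_H1_def)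
  define C where "C = K * (2 * sqrt c + L2_norm \<phi>0)"
  have "L2_norm \<phi>0 \<ge> 0" by (simp add: L2_norm_def)
  then have "C > 0" using \<open>K > 0\<close> \<open>c > 0\<close> by (simp add: C_def add_pos_nonneg)
  have "Linf_norm (\<lambda>x. \<phi> x - \<phi>0 x) \<le> ereal (C * root 4 b) \<and>
      L2_norm (\<lambda>x. \<phi> x - \<phi>0 x) \<le> C * root 4 b"
    if b: "0 < b" "b < 1" and prof: "soliton_profile c p b \<phi>" for b \<phi>
  proof
    have sq: "square_integrable \<phi>" using prof by (simp add: soliton_profile_def in_H1_def)
    have [measurable]: "\<phi> \<in> borel_measurable borel" "\<phi>0 \<in> borel_measurable borel"
      using sq sq0 by (simp_all add: square_integrable_def)
    have close: "AE x in lborel. \<bar>\<phi> x - \<phi>0 x\<bar> \<le> K * b * \<phi>0 x \<and> \<phi>0 x \<le> 2 * sqrt c"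
      unfolding K_def using soliton_profile_pointwise_close[OF assms(4) prof assms(1) \<open>c > 0\<close>] b by simp
    have rb: "b \<le> root 4 b" using b by (intro root_4_ge) auto
    have "AE x in lborel. ereal \<bar>\<phi> x - \<phi>0 x\<bar> \<le> ereal (C * root 4 b)"
      using close
    proof eventually_elim
      case (elim x)
      then have "\<bar>\<phi> x - \<phi>0 x\<bar> \<le> K * b * (2 * sqrt c)"
        using \<open>K > 0\<close> b by (auto elim: order_trans intro!: mult_left_mono)
      also have "\<dots> \<le> C * b"
        using \<open>K > 0\<close> b \<open>L2_norm \<phi>0 \<ge> 0\<close> by (simp add: C_def algebra_simps)
      also have "\<dots> \<le> C * root 4 b" using rb \<open>C > 0\<close> by simp
      finally show ?case by simp
    qed
    then show "Linf_norm (\<lambda>x. \<phi> x - \<phi>0 x) \<le> ereal (C * root 4 b)"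
      unfolding Linf_norm_def by (intro esssup_I) auto
    have int0: "integrable lborel (\<lambda>x. (\<phi>0 x)\<^sup>2)" using sq0 by (simp add: square_integrable_def)
    have "(LINT x|lborel. (\<phi> x - \<phi>0 x)\<^sup>2) \<le> (LINT x|lborel. (K * b)\<^sup>2 * (\<phi>0 x)\<^sup>2)"
    proof (rule integral_mono_AE')
      show "integrable lborel (\<lambda>x. (K * b)\<^sup>2 * (\<phi>0 x)\<^sup>2)" using int0 by simp
      show "AE x in lborel. (\<phi> x - \<phi>0 x)\<^sup>2 \<le> (K * b)\<^sup>2 * (\<phi>0 x)\<^sup>2"
        using close
      proof eventually_elim
        case (elim x)
        then have "\<bar>\<phi> x - \<phi>0 x\<bar>\<^sup>2 \<le> (K * b * \<phi>0 x)\<^sup>2" by (intro power_mono) auto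
        then show ?case by (simp add: power_mult_distrib)
      qed
    qed auto
    also have "\<dots> = (K * b)\<^sup>2 * (LINT x|lborel. (\<phi>0 x)\<^sup>2)" by simp
    finally have "L2_norm (\<lambda>x. \<phi> x - \<phi>0 x) \<le> sqrt ((K * b)\<^sup>2 * (LINT x|lborel. (\<phi>0 x)\<^sup>2))"
      unfolding L2_norm_def by (rule real_sqrt_le_mono)
    also have "\<dots> = K * L2_norm \<phi>0 * b"
      using \<open>K > 0\<close> b by (simp add: L2_norm_def real_sqrt_mult)
    also have "\<dots> \<le> C * b"
      using \<open>K > 0\<close> b \<open>c > 0\<close> by (intro mult_right_mono) (auto simp: C_def)
    also have "\<dots> \<le> C * root 4 b" using rb \<open>C > 0\<close> by simp
    finally show "L2_norm (\<lambda>x. \<phi> x - \<phi>0 x) \<le> C * root 4 b" .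
  qed
  with \<open>C > 0\<close> show ?thesis by (intro exI[of _ C] exI[of _ 1] conjI allI impI) auto
qed

end
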